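(* Let $n\geq 3$ be an integer and let $K_n$ be the complete graph on $n$ vertices. Then, for every $\gamma_R$-function $f$ of $K_n$, the minimum roman dominating distance energy of $K_n$ (computed from $f$) is $E_{RDd}(K_n)=2n-2$.
   Context: Graphs are finite and simple. A Roman dominating function (RDF) on a connected graph $G=(V,E)$ is a function $f:V\to\{0,1,2\}$ such that every vertex $u$ with $f(u)=0$ is adjacent to at least one vertex $v$ with $f(v)=2$. Its weight is $\sum_{v\in V}f(v)$; $\gamma_R(G)$ is the minimum weight of an RDF of $G$, and an RDF of weight $\gamma_R(G)$ is called a $\gamma_R$-function. Write $V_i=\{v\in V: f(v)=i\}$. Let $V=\{v_1,\dots,v_n\}$ and let $f$ be a $\gamma_R$-function of $G$. The minimum roman dominating distance matrix $A_{RDd}(G)=(\bar d_{ij})$ is the real symmetric $n\times n$ matrix with $\bar d_{ii}=2$ if $v_i\in V_2$, $\bar d_{ii}=1$ if $v_i\in V_1$, $\bar d_{ii}=0$ if $v_i\in V_0$, and $\bar d_{ij}=d(v_i,v_j)$ (graph distance) for $i\ne j$. The minimum roman dominating distance energy is $E_{RDd}(G)=\sum_{k=1}^n|\rho_k|$, where $\rho_1,\dots,\rho_n$ are the eigenvalues of $A_{RDd}(G)$ with multiplicity. *)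

theory Defs
  imports
    "Graph_Theory.Kuratowski"
    "Graph_Theory.Shortest_Path"
    "Jordan_Normal_Form.Char_Poly"
begin

text \<open>
  A finite simple graph is a symmetric digraph without loops and multiple arcs
  (locale \<^locale>\<open>graph\<close>), so adjacency of \<open>u\<close> and \<open>v\<close> is \<open>u \<rightarrow>\<^bsub>G\<^esub> v\<close>.
  Only the values of \<open>f\<close> on the vertices of \<open>G\<close> matter below.
\<close>

definition roman_dominating :: "('a, 'b) pre_digraph \<Rightarrow> ('a \<Rightarrow> nat) \<Rightarrow> bool" where
  "roman_dominating G f \<longleftrightarrow>
     (\<forall>u\<in>verts G. f u \<in> {0, 1, 2}) \<and>
     (\<forall>u\<in>verts G. f u = 0 \<longrightarrow> (\<exists>v\<in>verts G. u \<rightarrow>\<^bsub>G\<^esub> v \<and> f v = 2))"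

definition roman_weight :: "('a, 'b) pre_digraph \<Rightarrow> ('a \<Rightarrow> nat) \<Rightarrow> nat" where
  "roman_weight G f = (\<Sum>v\<in>verts G. f v)"

definition roman_domination_number :: "('a, 'b) pre_digraph \<Rightarrow> nat" where
  "roman_domination_number G = (LEAST w. \<exists>f. roman_dominating G f \<and> roman_weight G f = w)"

definition gamma_R_function :: "('a, 'b) pre_digraph \<Rightarrow> ('a \<Rightarrow> nat) \<Rightarrow> bool" where
  "gamma_R_function G f \<longleftrightarrow>
     roman_dominating G f \<and> roman_weight G f = roman_domination_number G"

definition roman_part :: "('a, 'b) pre_digraph \<Rightarrow> ('a \<Rightarrow> nat) \<Rightarrow> nat \<Rightarrow> 'a set" where
  "roman_part G f i = {v \<in> verts G. f v = i}"

text \<open>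
  The number of arcs of a shortest walk. If no walk exists, the infimum is \<open>\<infinity>\<close>, which
  \<^const>\<open>real_of_ereal\<close> sends to 0, so this is the distance only in connected graphs.
\<close>

definition graph_dist :: "('a, 'b) pre_digraph \<Rightarrow> 'a \<Rightarrow> 'a \<Rightarrow> real" where
  "graph_dist G u v = real_of_ereal (wf_digraph.\<mu> G (\<lambda>_. 1) u v)"

text \<open>\<open>v\<close> enumerates the vertices of \<open>G\<close>, with indices \<open>0, \<dots>, n - 1\<close> instead of \<open>1, \<dots>, n\<close>.\<close>

definition roman_dist_matrix ::
    "('a, 'b) pre_digraph \<Rightarrow> ('a \<Rightarrow> nat) \<Rightarrow> (nat \<Rightarrow> 'a) \<Rightarrow> real mat" where
  "roman_dist_matrix G f v = mat (card (verts G)) (card (verts G)) (\<lambda>(i, j).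
     if i = j then
       (if v i \<in> roman_part G f 2 then 2 else if v i \<in> roman_part G f 1 then 1 else 0)
     else graph_dist G (v i) (v j))"

text \<open>
  The eigenvalues with multiplicity are taken as the complex roots of the characteristic
  polynomial, so that there are always as many of them as rows.
\<close>

definition matrix_energy :: "real mat \<Rightarrow> real" where
  "matrix_energy A = (\<Sum>\<rho>\<in>#proots (char_poly (map_mat complex_of_real A)). cmod \<rho>)"

definition roman_dist_energy ::
    "('a, 'b) pre_digraph \<Rightarrow> ('a \<Rightarrow> nat) \<Rightarrow> (nat \<Rightarrow> 'a) \<Rightarrow> real" where
  "roman_dist_energy G f v = matrix_energy (roman_dist_matrix G f v)"

end

theory Submission
  imports Defs
begin

text \<open>
  A \<open>\<gamma>\<^sub>R\<close>-function of \<open>K\<^sub>n\<close> with \<open>n \<ge> 3\<close> has weight 2 and can only be 2 on one vertex and 0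
  elsewhere, so the matrix is \<open>J - I\<close> with one diagonal entry raised to 2. Its characteristic
  polynomial is \<open>(x + 1)\<^bsup>n - 2\<^esup> (x\<^sup>2 - n x + n - 3)\<close>. The quadratic has two nonnegative real roots
  of sum \<open>n\<close>, hence the energy is \<open>(n - 2) + n\<close>.
\<close>

text \<open>The last row is constantly \<open>c\<close>, and adding it to every other row of a lower
  triangular matrix produces the rest. So the matrix factors as \<open>L * T\<close>, where the unit
  upper triangular \<open>L\<close> performs these row additions and \<open>T\<close> has diagonal
  \<open>d 0, ..., d (n - 1), c\<close>.\<close>

lemma det_diag_plus_const_last_row:
  fixes d :: "nat \<Rightarrow> 'a :: comm_ring_1"
  shows "det (mat (Suc n) (Suc n) (\<lambda>(i, j). (if i = j \<and> i < n then d i else 0) + c))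
    = c * (\<Prod>i<n. d i)"
proof -
  define L :: "'a mat" where
    "L = mat (Suc n) (Suc n) (\<lambda>(i, j). if i = j \<or> j = n then 1 else 0)"
  define T where
    "T = mat (Suc n) (Suc n) (\<lambda>(i, j). if i = n then c else if i = j then d i else 0)"
  have L: "L \<in> carrier_mat (Suc n) (Suc n)" and T: "T \<in> carrier_mat (Suc n) (Suc n)"
    by (simp_all add: L_def T_def)
  have "mat (Suc n) (Suc n) (\<lambda>(i, j). (if i = j \<and> i < n then d i else 0) + c) = L * T"
  proof (rule eq_matI)
    fix i j assume "i < dim_row (L * T)" "j < dim_col (L * T)"
    then have ij: "i < Suc n" "j < Suc n" using L T by auto
    \<comment> \<open>The summand with index \<open>n\<close> is split off: the last column of
      \<open>L\<close> is all ones and the last row of \<open>T\<close> is all \<open>c\<close>, so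
      it equals \<open>c\<close> for every entry.\<close>
    have "(L * T) $$ (i, j) = (\<Sum>k<n. (if i = k \<or> k = n then 1 else 0) *
        (if k = n then c else if k = j then d k else 0)) + c"
      using ij by (simp add: L_def T_def scalar_prod_def lessThan_atLeast0)
    also have "(\<Sum>k<n. (if i = k \<or> k = n then 1 else 0) *
        (if k = n then c else if k = j then d k else 0))
      = (\<Sum>k<n. if k = i then (if i = j then d i else 0) else 0)"
      by (intro sum.cong) auto
    also have "\<dots> = (if i = j \<and> i < n then d i else 0)"
      by simp
    finally show "mat (Suc n) (Suc n) (\<lambda>(i, j). (if i = j \<and> i < n then d i else 0) + c) $$ (i, j)
      = (L * T) $$ (i, j)"
      using ij by simp
  qed (use L T in auto)
  moreover have "det L = 1"
    by (subst det_upper_triangular[OF _ L])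
      (auto simp: L_def upper_triangular_def prod_list_diag_prod)
  moreover have "det T = c * (\<Prod>i<n. d i)"
    by (subst det_lower_triangular[OF _ T])
      (auto simp: T_def prod_list_diag_prod lessThan_atLeast0 mult.commute)
  ultimately show ?thesis using det_mult[OF L T] by simp
qed

text \<open>This is the matrix determinant lemma for a diagonal matrix plus \<open>c\<close> times
  the all-ones matrix. It is stated with products omitting one index instead of quotients by
  \<open>d i\<close>, so that it holds in any commutative ring, in particular for polynomials. The
  induction uses linearity of the determinant in the last row.\<close>

lemma det_diag_plus_const:
  fixes d :: "nat \<Rightarrow> 'a :: comm_ring_1"
  shows "det (mat n n (\<lambda>(i, j). (if i = j then d i else 0) + c))
    = (\<Prod>i<n. d i) + c * (\<Sum>i<n. \<Prod>j\<in>{..<n} - {i}. d j)"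
proof (induction n)
  case 0
  then show ?case by (simp add: det_dim_zero)
next
  case (Suc n)
  define M where "M m = mat m m (\<lambda>(i, j). (if i = j then d i else 0) + c)" for m
  define N where
    "N = mat (Suc n) (Suc n) (\<lambda>(i, j). (if i = j \<and> i < n then d i else 0) + c)"
  have M: "M (Suc n) \<in> carrier_mat (Suc n) (Suc n)" and N: "N \<in> carrier_mat (Suc n) (Suc n)"
    by (simp_all add: M_def N_def)
  \<comment> \<open>\<open>N\<close> and \<open>M (Suc n)\<close> differ only at position
    \<open>(n, n)\<close>, where \<open>N\<close> lacks the summand \<open>d n\<close>. Deleting row
    \<open>n\<close> removes that difference, so both have the same cofactors along this
    row.\<close>
  have "mat_delete N n j = mat_delete (M (Suc n)) n j" for j
    unfolding mat_delete_def by (rule eq_matI) (auto simp: M_def N_def)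
  then have cof: "cofactor N n j = cofactor (M (Suc n)) n j" for j
    by (simp add: cofactor_def)
  have "mat_delete (M (Suc n)) n n = M n"
    unfolding mat_delete_def by (rule eq_matI) (auto simp: M_def)
  then have last: "cofactor (M (Suc n)) n n = det (M n)"
    by (simp add: cofactor_def)
  have "det (M (Suc n)) = (\<Sum>j<Suc n. M (Suc n) $$ (n, j) * cofactor (M (Suc n)) n j)"
    using laplace_expansion_row[OF M] by blast
  also have "\<dots> = (\<Sum>j<Suc n. N $$ (n, j) * cofactor N n j) + d n * det (M n)"
    by (simp add: cof last) (simp add: M_def N_def algebra_simps)
  also have "(\<Sum>j<Suc n. N $$ (n, j) * cofactor N n j) = det N"
    using laplace_expansion_row[OF N, of n] by simp
  also have "det N = c * (\<Prod>i<n. d i)"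
    unfolding N_def by (rule det_diag_plus_const_last_row)
  finally have det_M: "det (M (Suc n)) = c * (\<Prod>i<n. d i) + d n * det (M n)" .
  have "(\<Prod>j\<in>{..<Suc n} - {i}. d j) = d n * (\<Prod>j\<in>{..<n} - {i}. d j)" if "i < n" for i
  proof -
    have "{..<Suc n} - {i} = insert n ({..<n} - {i})" using that by auto
    then show ?thesis by simp
  qed
  moreover have "{..<Suc n} - {n} = {..<n}" by auto
  ultimately have "(\<Sum>i<Suc n. \<Prod>j\<in>{..<Suc n} - {i}. d j)
      = d n * (\<Sum>i<n. \<Prod>j\<in>{..<n} - {i}. d j) + (\<Prod>i<n. d i)"
    by (simp add: sum_distrib_left)
  with det_M Suc.IH show ?case
    unfolding M_def by (simp add: algebra_simps)
qed

lemma char_poly_ones_minus_id_diag_two: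
  assumes "k < n" "n \<ge> 2"
  shows "char_poly (mat n n (\<lambda>(i, j). if i = j then (if i = k then 2 else 0) else 1))
    = [:1, 1:] ^ (n - 2) * [:of_nat n - 3, - of_nat n, 1 :: 'a :: comm_ring_1:]"
    (is "char_poly ?A = _")
proof -
  \<comment> \<open>All off-diagonal entries of xI - A are -1, so xI - A is a diagonal matrix minus
    the all-ones matrix. Its diagonal entries x and x - 2 are therefore written as (x + 1) - 1 and
    (x - 1) - 1.\<close>
  define d :: "nat \<Rightarrow> 'a poly" where "d i = (if i = k then [:-1, 1:] else [:1, 1:])" for i
  \<comment> \<open>This removes the truncated subtraction in the exponent
    \<open>n - 2\<close>.\<close>
  obtain m where m: "n = Suc (Suc m)"
    using \<open>n \<ge> 2\<close> by (metis Suc_le_D numeral_2_eq_2 Suc_le_mono)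
  have "char_poly_matrix ?A = mat n n (\<lambda>(i, j). (if i = j then d i else 0) + (- 1))"
    by (rule eq_matI) (auto simp: char_poly_matrix_def d_def one_pCons)
  then have "char_poly ?A = (\<Prod>i<n. d i) - (\<Sum>i<n. \<Prod>j\<in>{..<n} - {i}. d j)"
    using det_diag_plus_const[of n d "- 1"] by (simp add: char_poly_def)
  also have "(\<Prod>i<n. d i) = [:-1, 1:] * [:1, 1:] ^ Suc m"
  proof -
    have "(\<Prod>i<n. d i) = d k * (\<Prod>i\<in>{..<n} - {k}. d i)"
      using \<open>k < n\<close> by (intro prod.remove) auto
    also have "(\<Prod>i\<in>{..<n} - {k}. d i) = (\<Prod>i\<in>{..<n} - {k}. [:1, 1:])"
      by (intro prod.cong) (auto simp: d_def)
    finally show ?thesis using \<open>k < n\<close> by (simp add: d_def m)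
  qed
  \<comment> \<open>Omitting index \<open>k\<close> leaves only factors x + 1; omitting any of the
    other \<open>n - 1\<close> indices keeps the single factor x - 1.\<close>
  also have "(\<Sum>i<n. \<Prod>j\<in>{..<n} - {i}. d j)
      = [:1, 1:] ^ Suc m + of_nat (Suc m) * ([:-1, 1:] * [:1, 1:] ^ m)"
  proof -
    have "(\<Prod>j\<in>{..<n} - {i}. d j) = [:-1, 1:] * [:1, 1:] ^ m" if "i < n" "i \<noteq> k" for i
    proof -
      have "(\<Prod>j\<in>{..<n} - {i}. d j) = d k * (\<Prod>j\<in>{..<n} - {i} - {k}. d j)"
        using \<open>k < n\<close> that by (intro prod.remove) auto
      also have "(\<Prod>j\<in>{..<n} - {i} - {k}. d j) = (\<Prod>j\<in>{..<n} - {i} - {k}. [:1, 1:])"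
        by (intro prod.cong) (auto simp: d_def)
      finally show ?thesis using \<open>k < n\<close> that by (simp add: d_def m)
    qed
    moreover have "(\<Prod>j\<in>{..<n} - {k}. d j) = [:1, 1:] ^ Suc m"
    proof -
      have "(\<Prod>j\<in>{..<n} - {k}. d j) = (\<Prod>j\<in>{..<n} - {k}. [:1, 1:])"
        by (intro prod.cong) (auto simp: d_def)
      then show ?thesis using \<open>k < n\<close> by (simp add: m)
    qed
    moreover have "(\<Sum>i<n. \<Prod>j\<in>{..<n} - {i}. d j)
        = (\<Prod>j\<in>{..<n} - {k}. d j) + (\<Sum>i\<in>{..<n} - {k}. \<Prod>j\<in>{..<n} - {i}. d j)"
      using \<open>k < n\<close> by (intro sum.remove) auto
    ultimately show ?thesis using \<open>k < n\<close> by (simp add: m)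
  qed
  also have "[:-1, 1:] * [:1, 1:] ^ Suc m
      - ([:1, 1:] ^ Suc m + of_nat (Suc m) * ([:-1, 1:] * [:1, 1:] ^ m))
    = [:1, 1:] ^ m * ([:-1, 1:] * [:1, 1:] - [:1, 1:] - of_nat (Suc m) * [:-1, 1 :: 'a:])"
    by (simp only: power_Suc) (simp only: algebra_simps)
  also have "[:-1, 1:] * [:1, 1:] - [:1, 1:] - of_nat (Suc m) * [:-1, 1 :: 'a:]
      = [:of_nat n - 3, - of_nat n, 1:]"
    by (simp add: m of_nat_poly)
  finally show ?thesis by (simp add: m)
qed

lemma matrix_energy_ones_minus_id_diag_two:
  assumes "k < n" "n \<ge> 3"
  shows "matrix_energy (mat n n (\<lambda>(i, j). if i = j then (if i = k then 2 else 0) else 1))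
    = 2 * real n - 2"
proof -
  define s where "s = sqrt ((real n)\<^sup>2 - 4 * (real n - 3))"
  define r1 r2 where "r1 = (real n + s) / 2" and "r2 = (real n - s) / 2"
  \<comment> \<open>This is the discriminant of the quadratic factor with the square
    completed.\<close>
  have "0 \<le> (real n - 2)\<^sup>2 + 8" by simp
  then have disc: "0 \<le> (real n)\<^sup>2 - 4 * (real n - 3)"
    by (simp add: power2_eq_square algebra_simps)
  then have s2: "s\<^sup>2 = (real n)\<^sup>2 - 4 * (real n - 3)" by (simp add: s_def)
  have "0 \<le> s" using disc by (simp add: s_def)
  have "s \<le> real n" unfolding s_def using assms by (intro real_le_lsqrt) auto
  have sum: "r1 + r2 = real n" by (simp add: r1_def r2_def field_simps)
  have prod: "r1 * r2 = real n - 3"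
    using s2 by (simp add: r1_def r2_def field_simps power2_eq_square)
  have quad: "[:of_nat n - 3, - of_nat n, 1:] = [:- complex_of_real r1, 1:] * [:- complex_of_real r2, 1:]"
    using arg_cong[OF sum, of complex_of_real] arg_cong[OF prod, of complex_of_real]
    by (simp add: algebra_simps)
  have "map_mat complex_of_real (mat n n (\<lambda>(i, j). if i = j then (if i = k then 2 else 0) else 1))
      = mat n n (\<lambda>(i, j). if i = j then (if i = k then 2 else 0) else 1)"
    by (rule eq_matI) auto
  then have "matrix_energy (mat n n (\<lambda>(i, j). if i = j then (if i = k then 2 else 0) else 1))
      = (\<Sum>\<rho>\<in>#proots ([:1, 1:] ^ (n - 2) *
          ([:- complex_of_real r1, 1:] * [:- complex_of_real r2, 1:])). cmod \<rho>)"
    using char_poly_ones_minus_id_diag_two[of k n, where ?'a = complex] assms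
    by (simp only: matrix_energy_def quad)
  also have "proots ([:1, 1:] ^ (n - 2) * ([:- complex_of_real r1, 1:] * [:- complex_of_real r2, 1:]))
      = repeat_mset (n - 2) {#-1#} + ({#complex_of_real r1#} + {#complex_of_real r2#})"
    by (subst proots_mult, simp, simp, subst proots_mult, simp, simp) (simp add: proots_power)
  also have "(\<Sum>\<rho>\<in>#\<dots>. cmod \<rho>) = real (n - 2) + (\<bar>r1\<bar> + \<bar>r2\<bar>)"
    by simp
  also have "\<bar>r1\<bar> + \<bar>r2\<bar> = real n"
    using sum \<open>0 \<le> s\<close> \<open>s \<le> real n\<close> by (simp add: r1_def r2_def)
  finally show ?thesis using assms by (simp add: of_nat_diff)
qed

text \<open>The arc from \<open>x\<close> to \<open>y\<close> is a walk of cost 1, and the only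
  cheaper walk, the empty one, cannot join distinct vertices. The infimum is thus finite and
  survives the conversion from extended reals.\<close>

lemma graph_dist_complete_digraph:
  assumes "complete_digraph n G" "x \<in> verts G" "y \<in> verts G" "x \<noteq> y"
  shows "graph_dist G x y = 1"
proof -
  interpret graph G using assms(1) by (simp add: complete_digraph_def)
  have "(x, y) \<in> arcs_ends G" using assms by (auto simp: complete_digraph_def)
  then obtain e where e: "e \<in> arcs G" "tail G e = x" "head G e = y"
    by (auto simp: arcs_ends_conv)
  then have "awalk x [e] y" using arc_implies_awalk by blast
  then have "\<mu> (\<lambda>_. 1) x y \<le> 1"
    using min_cost_le_walk_cost[of x "[e]" y "\<lambda>_. 1"] by (simp add: one_ereal_def)
  moreover have "1 \<le> \<mu> (\<lambda>_. 1) x y"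
    unfolding \<mu>_def
  proof (rule INF_greatest)
    fix p assume "p \<in> {p. awalk x p y}"
    then have "p \<noteq> []" using \<open>x \<noteq> y\<close> by (auto simp: awalk_Nil_iff)
    then have "1 \<le> length p" by (cases p) auto
    then show "1 \<le> ereal (awalk_cost (\<lambda>_. 1) p)"
      by (simp add: awalk_cost_def sum_list_triv)
  qed
  ultimately have "\<mu> (\<lambda>_. 1) x y = 1" by (rule antisym)
  then show ?thesis by (simp add: graph_dist_def)
qed

text \<open>A single 2 dominates everything, so the minimum weight is at most 2. Without a value 2
  no vertex may have value 0, and the weight would be at least \<open>n\<close>. The bound
  \<open>n \<ge> 3\<close> excludes this; on two vertices the constant 1 is also optimal.\<close>

lemma gamma_R_function_complete_digraph:
  assumes "complete_digraph n G" "n \<ge> 3" "gamma_R_function G f"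
  obtains x where "x \<in> verts G" "f x = 2" "\<And>y. y \<in> verts G \<Longrightarrow> y \<noteq> x \<Longrightarrow> f y = 0"
proof -
  interpret graph G using assms(1) by (simp add: complete_digraph_def)
  have card: "card (verts G) = n" using assms(1) by (simp add: complete_digraph_def)
  have adj: "u \<rightarrow>\<^bsub>G\<^esub> w" if "u \<in> verts G" "w \<in> verts G" "u \<noteq> w" for u w
    using assms(1) that by (auto simp: complete_digraph_def)
  obtain z where z: "z \<in> verts G" using card \<open>n \<ge> 3\<close> by fastforce
  define h where "h w = (if w = z then 2 else 0 :: nat)" for w
  have "roman_dominating G h"
    using z adj by (auto simp: roman_dominating_def h_def)
  moreover have "roman_weight G h = 2"
    using z by (simp add: roman_weight_def h_def)
  ultimately have "roman_domination_number G \<le> 2"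
    unfolding roman_domination_number_def by (intro Least_le) blast
  then have weight: "(\<Sum>w\<in>verts G. f w) \<le> 2" and dom: "roman_dominating G f"
    using assms(3) by (auto simp: gamma_R_function_def roman_weight_def)
  have "\<exists>x\<in>verts G. f x = 2"
  proof (rule ccontr)
    assume "\<not> ?thesis"
    then have "1 \<le> f w" if "w \<in> verts G" for w
      using dom that by (fastforce simp: roman_dominating_def)
    then have "(\<Sum>w\<in>verts G. 1) \<le> (\<Sum>w\<in>verts G. f w)" by (intro sum_mono)
    with weight card \<open>n \<ge> 3\<close> show False by simp
  qed
  then obtain x where x: "x \<in> verts G" "f x = 2" by blast
  \<comment> \<open>The value at \<open>x\<close> already exhausts the weight, and the remaining
    values are natural numbers.\<close>
  then have "(\<Sum>w\<in>verts G - {x}. f w) = 0"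
    using weight sum.remove[of "verts G" x f] by simp
  then have "f y = 0" if "y \<in> verts G" "y \<noteq> x" for y using that by simp
  with x that show thesis by blast
qed

theorem theorem3p1:
  fixes G :: "('a, 'b) pre_digraph"
    and n :: nat
    and f :: "'a \<Rightarrow> nat"
    and v :: "nat \<Rightarrow> 'a"
  assumes "n \<ge> 3"
    and "complete_digraph n G"
    and "bij_betw v {..<n} (verts G)"
    and "gamma_R_function G f"
  shows "roman_dist_energy G f v = 2 * real n - 2"
proof -
  obtain x where x: "x \<in> verts G" "f x = 2" "\<And>y. y \<in> verts G \<Longrightarrow> y \<noteq> x \<Longrightarrow> f y = 0"
    using gamma_R_function_complete_digraph assms by blast
  have inj: "inj_on v {..<n}" and v: "v ` {..<n} = verts G"
    using assms(3) by (auto simp: bij_betw_def)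
  \<comment> \<open>The index of \<open>x\<close> in the enumeration is the position of the diagonal
    entry 2. The energy computed above is the same for every such position.\<close>
  then obtain k where k: "k < n" "v k = x" using x(1) by force
  have card: "card (verts G) = n" using assms(2) by (simp add: complete_digraph_def)
  have "roman_dist_matrix G f v
      = mat n n (\<lambda>(i, j). if i = j then (if i = k then 2 else 0) else 1)"
  proof (rule eq_matI)
    fix i j
    assume "i < dim_row (mat n n (\<lambda>(i, j). if i = j then (if i = k then 2 else 0) else 1 :: real))"
      and "j < dim_col (mat n n (\<lambda>(i, j). if i = j then (if i = k then 2 else 0) else 1 :: real))"
    then have ij: "i < n" "j < n" by simp_all
    then have verts: "v i \<in> verts G" "v j \<in> verts G" using v by auto
    \<comment> \<open>Injectivity of \<open>v\<close> turns comparisons of vertices into comparisons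
      of indices, so off-diagonal entries are distances between distinct vertices.\<close>
    have eq: "v i = v j \<longleftrightarrow> i = j" "v i = x \<longleftrightarrow> i = k"
      using inj ij k by (auto simp: inj_on_def)
    show "roman_dist_matrix G f v $$ (i, j)
        = mat n n (\<lambda>(i, j). if i = j then (if i = k then 2 else 0) else 1) $$ (i, j)"
      using ij verts eq x k graph_dist_complete_digraph[OF assms(2) verts]
      by (auto simp: roman_dist_matrix_def card roman_part_def)
  qed (simp_all add: roman_dist_matrix_def card)
  then show ?thesis
    using matrix_energy_ones_minus_id_diag_two[OF k(1) assms(1)]
    by (simp add: roman_dist_energy_def)
qed

end
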